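(* Consider the problem $$\text{(P)}\quad \min_{x_1,\dots,x_N}\ \sum_{i\in\mathcal I} f_i(x_i)\quad\text{s.t.}\quad \sum_{i\in\mathcal I}\big(a_i^{m\top}x_i+b_i^m\big)\le 0,\quad m\in\mathcal M,$$ and, for $y\in\mathbb R^{NM}$ and $i\in\mathcal I$, let $\phi_i(y)$ be the optimal value of the local problem $$\text{(L}_i\text{)}\quad \min_{x_i}\ f_i(x_i)\quad\text{s.t.}\quad a_i^{m\top}x_i+\sum_{j\in N_i}(y_i^m-y_j^m)+b_i^m\le 0,\quad m\in\mathcal M,$$ and $\phi(y)=\sum_{i\in\mathcal I}\phi_i(y)$. Assume that each $f_i$ is convex; that the optimal value of (P) is finite; and that for every $y\in\mathbb R^{NM}$ and every $i\in\mathcal I$ there exists $x_i$ that is strictly feasible for (L$_i$). Denote by $c_i=(c_i^1,\dots,c_i^M)\in\mathbb R^M$ a Lagrange multiplier of (L$_i$) (for the given $y$), $i\in\mathcal I$. Define $\zeta_i^m=\sum_{j\in N_i}(c_i^m-c_j^m)$, $\zeta^m=(\zeta_1^m,\dots,\zeta_N^m)$, $\zeta=[\zeta^1;\zeta^2;\dots;\zeta^M]$. Then: 1) $c_i\in\mathbb R^M$, not necessarily unique, always exists; 2) $\phi(\cdot)$ is convex, but not strongly convex; 3) $\zeta\in\partial\phi(y)$.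
   Context: $\mathcal I=\{1,\dots,N\}$ indexes agents and $\mathcal M=\{1,\dots,M\}$ indexes coupling constraints; $a_i^m,x_i\in\mathbb R^{d_i}$, $b_i^m\in\mathbb R$, $f_i:\mathbb R^{d_i}\to\mathbb R$. $\mathcal G=(\mathcal I,E)$ is a connected undirected graph and $N_i$ is the set of neighbors of $i$. Auxiliary variables $y_i^m\in\mathbb R$ are collected as $y^m=(y_1^m,\dots,y_N^m)$, $y=[y^1;\dots;y^M]\in\mathbb R^{NM}$. A Lagrange multiplier of (L$_i$) is a vector $c_i\ge 0$ of multipliers for its $M$ inequality constraints for which strong duality holds, i.e. $\phi_i(y)=\inf_{x_i}\big[f_i(x_i)+\sum_{m}c_i^m\big(a_i^{m\top}x_i+\sum_{j\in N_i}(y_i^m-y_j^m)+b_i^m\big)\big]$. $\partial\phi(y)$ is the convex subdifferential: the set of $s$ with $\phi(y')\ge\phi(y)+s^\top(y'-y)$ for all $y'$. *)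

theory Defs
  imports
    "HOL-Analysis.Analysis"
    "Jordan_Normal_Form.Matrix"
begin

no_notation vec_index (infixl \<open>$\<close> 100)
no_notation scalar_prod (infix \<open>\<bullet>\<close> 70)

text \<open>
  Agents are the elements of a finite type \<open>'n\<close> and coupling constraints those of a finite
  type \<open>'m\<close>. The decision dimension depends on the agent, so the decision of agent \<open>i\<close> is an element
  of \<open>carrier_vec (d i)\<close>. A cost function \<open>f i\<close> is only meaningful on that carrier.
  The auxiliary variable \<open>y :: real^'n^'m\<close> has entry \<open>y $ m $ i\<close> for constraint \<open>m\<close> and agent \<open>i\<close>;
  the inner product and norm of this type are the Euclidean ones of dimension \<open>N * M\<close>.
\<close>

text \<open>The type \<open>real Matrix.vec\<close> is not a \<open>real_vector\<close>, so \<open>convex_on\<close> does not apply.\<close>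

definition convex_carrier :: "nat \<Rightarrow> (real Matrix.vec \<Rightarrow> real) \<Rightarrow> bool" where
  "convex_carrier k g \<longleftrightarrow>
     (\<forall>u\<in>carrier_vec k. \<forall>v\<in>carrier_vec k. \<forall>t\<in>{0..1}.
        g ((1 - t) \<cdot>\<^sub>v u + t \<cdot>\<^sub>v v) \<le> (1 - t) * g u + t * g v)"

definition coupled_feasible ::
  "('n::finite \<Rightarrow> nat) \<Rightarrow> ('n \<Rightarrow> 'm::finite \<Rightarrow> real Matrix.vec) \<Rightarrow> ('n \<Rightarrow> 'm \<Rightarrow> real)
    \<Rightarrow> ('n \<Rightarrow> real Matrix.vec) set" where
  "coupled_feasible d a b =
     {x. (\<forall>i. x i \<in> carrier_vec (d i)) \<and>
         (\<forall>m. (\<Sum>i\<in>UNIV. scalar_prod (a i m) (x i) + b i m) \<le> 0)}"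

definition coupled_value ::
  "('n::finite \<Rightarrow> nat) \<Rightarrow> ('n \<Rightarrow> real Matrix.vec \<Rightarrow> real) \<Rightarrow> ('n \<Rightarrow> 'm::finite \<Rightarrow> real Matrix.vec)
    \<Rightarrow> ('n \<Rightarrow> 'm \<Rightarrow> real) \<Rightarrow> ereal" where
  "coupled_value d f a b =
     (INF x\<in>coupled_feasible d a b. ereal (\<Sum>i\<in>UNIV. f i (x i)))"

definition local_constraint ::
  "('n::finite \<times> 'n) set \<Rightarrow> ('n \<Rightarrow> 'm::finite \<Rightarrow> real Matrix.vec) \<Rightarrow> ('n \<Rightarrow> 'm \<Rightarrow> real)
    \<Rightarrow> 'n \<Rightarrow> real^'n^'m \<Rightarrow> 'm \<Rightarrow> real Matrix.vec \<Rightarrow> real" where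
  "local_constraint E a b i y m x =
     scalar_prod (a i m) x + (\<Sum>j\<in>E `` {i}. y $ m $ i - y $ m $ j) + b i m"

definition local_feasible ::
  "('n::finite \<times> 'n) set \<Rightarrow> ('n \<Rightarrow> nat) \<Rightarrow> ('n \<Rightarrow> 'm::finite \<Rightarrow> real Matrix.vec)
    \<Rightarrow> ('n \<Rightarrow> 'm \<Rightarrow> real) \<Rightarrow> 'n \<Rightarrow> real^'n^'m \<Rightarrow> real Matrix.vec set" where
  "local_feasible E d a b i y =
     {x \<in> carrier_vec (d i). \<forall>m. local_constraint E a b i y m x \<le> 0}"

definition local_value ::
  "('n::finite \<times> 'n) set \<Rightarrow> ('n \<Rightarrow> nat) \<Rightarrow> ('n \<Rightarrow> real Matrix.vec \<Rightarrow> real)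
    \<Rightarrow> ('n \<Rightarrow> 'm::finite \<Rightarrow> real Matrix.vec) \<Rightarrow> ('n \<Rightarrow> 'm \<Rightarrow> real)
    \<Rightarrow> 'n \<Rightarrow> real^'n^'m \<Rightarrow> ereal" where
  "local_value E d f a b i y = (INF x\<in>local_feasible E d a b i y. ereal (f i x))"

definition total_value ::
  "('n::finite \<times> 'n) set \<Rightarrow> ('n \<Rightarrow> nat) \<Rightarrow> ('n \<Rightarrow> real Matrix.vec \<Rightarrow> real)
    \<Rightarrow> ('n \<Rightarrow> 'm::finite \<Rightarrow> real Matrix.vec) \<Rightarrow> ('n \<Rightarrow> 'm \<Rightarrow> real)
    \<Rightarrow> real^'n^'m \<Rightarrow> ereal" where
  "total_value E d f a b y = (\<Sum>i\<in>UNIV. local_value E d f a b i y)"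

definition lagrange_multiplier ::
  "('n::finite \<times> 'n) set \<Rightarrow> ('n \<Rightarrow> nat) \<Rightarrow> ('n \<Rightarrow> real Matrix.vec \<Rightarrow> real)
    \<Rightarrow> ('n \<Rightarrow> 'm::finite \<Rightarrow> real Matrix.vec) \<Rightarrow> ('n \<Rightarrow> 'm \<Rightarrow> real)
    \<Rightarrow> 'n \<Rightarrow> real^'n^'m \<Rightarrow> real^'m \<Rightarrow> bool" where
  "lagrange_multiplier E d f a b i y c \<longleftrightarrow>
     (\<forall>m. 0 \<le> c $ m) \<and>
     local_value E d f a b i y =
       (INF x\<in>carrier_vec (d i).
          ereal (f i x + (\<Sum>m\<in>UNIV. c $ m * local_constraint E a b i y m x)))"

definition zeta ::
  "('n::finite \<times> 'n) set \<Rightarrow> ('n \<Rightarrow> real^'m::finite) \<Rightarrow> real^'n^'m" where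
  "zeta E c = (\<chi> m i. \<Sum>j\<in>E `` {i}. c i $ m - c j $ m)"

definition subdifferential :: "('v::real_inner \<Rightarrow> ereal) \<Rightarrow> 'v \<Rightarrow> 'v set" where
  "subdifferential g y = {s. \<forall>y'. g y' \<ge> g y + ereal (inner s (y' - y))}"

definition strongly_convex :: "('v::real_normed_vector \<Rightarrow> real) \<Rightarrow> bool" where
  "strongly_convex g \<longleftrightarrow>
     (\<exists>\<mu>>0. \<forall>u v. \<forall>t\<in>{0..1}.
        g ((1 - t) *\<^sub>R u + t *\<^sub>R v)
          \<le> (1 - t) * g u + t * g v - \<mu> / 2 * t * (1 - t) * (norm (u - v))\<^sup>2)"

text \<open>An undirected graph is a symmetric irreflexive relation; the neighbours of \<open>i\<close> are \<open>E `` {i}\<close>.\<close>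

locale coupled_problem =
  fixes E :: "('n::finite \<times> 'n) set"
    and d :: "'n \<Rightarrow> nat"
    and f :: "'n \<Rightarrow> real Matrix.vec \<Rightarrow> real"
    and a :: "'n \<Rightarrow> 'm::finite \<Rightarrow> real Matrix.vec"
    and b :: "'n \<Rightarrow> 'm \<Rightarrow> real"
  assumes graph_sym: "sym E"
    and graph_irrefl: "irrefl E"
    and graph_connected: "\<And>i j. (i, j) \<in> E\<^sup>*"
    and dim_coeff: "\<And>i m. a i m \<in> carrier_vec (d i)"
    and convex_cost: "\<And>i. convex_carrier (d i) (f i)"
    and finite_value: "\<bar>coupled_value d f a b\<bar> \<noteq> \<infinity>"
    and strictly_feasible:
      "\<And>(y::real^'n^'m) i. \<exists>x\<in>carrier_vec (d i). \<forall>m. local_constraint E a b i y m x < 0"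

end

theory Submission
  imports Defs
begin

text \<open>
  Multipliers exist by Slater's condition: the set of all (constraint bound, cost) pairs that
  can be strictly attained is convex and misses the optimal pair, and the normal of a separating
  hyperplane, rescaled, is a multiplier. A multiplier bounds each local value below by
  an affine function of \<open>y\<close>; adding these bounds up and using that the graph Laplacian is
  self-adjoint gives \<open>\<zeta> \<in> \<partial>\<phi>(y)\<close>. As \<open>\<phi>\<close> is finite and has a subgradient everywhere, it is convex.
  It is not strongly convex because the Laplacian kills constants, so \<open>\<phi>\<close> is constant along the
  all-ones direction.
\<close>

section \<open>Lagrange multipliers from Slater's condition\<close>

lemma slope_nonneg_of_affine_nonneg:
  fixes K L :: real
  assumes "\<And>s. 0 < s \<Longrightarrow> 0 \<le> K + s * L"
  shows "0 \<le> L"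
proof (rule ccontr)
  assume "\<not> 0 \<le> L"
  \<comment> \<open>At this \<open>s\<close> the affine expression equals \<open>K\<close> -
    |\<open>K\<close>| - 1, which is negative.\<close>
  then have "0 < (\<bar>K\<bar> + 1) / - L" by (intro divide_pos_pos) auto
  from assms[OF this] \<open>\<not> 0 \<le> L\<close> show False by simp
qed

lemma intercept_nonneg_of_affine_nonneg:
  fixes K L :: real
  assumes "\<And>s. 0 < s \<Longrightarrow> 0 \<le> K + s * L"
  shows "0 \<le> K"
proof (rule slope_nonneg_of_affine_nonneg)
  fix s :: real assume "0 < s"
  \<comment> \<open>Evaluating at \<open>1 / s\<close> and multiplying by \<open>s\<close> exchanges
    slope and intercept.\<close>
  then have "0 \<le> s * (K + inverse s * L)" using assms[of "inverse s"] by simp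
  also have "\<dots> = L + s * K" using \<open>0 < s\<close> by (simp add: distrib_left)
  finally show "0 \<le> L + s * K" .
qed

text \<open>The origin is separated from a convex set in (\<open>real^'m\<close>)
  \<open>\<times> real\<close>, so only the images of \<open>g\<close> and \<open>h\<close> need
  linear structure. Convexity is therefore asked for in the form of a dominating point
  \<open>w\<close>, which lets \<open>X\<close> be a carrier set whose type is not a vector
  space.\<close>

lemma slater_multiplier:
  fixes g :: "'m::finite \<Rightarrow> 'x \<Rightarrow> real" and h :: "'x \<Rightarrow> real"
  assumes convex_like: "\<And>u v t. u \<in> X \<Longrightarrow> v \<in> X \<Longrightarrow> t \<in> {0..1} \<Longrightarrow>
      \<exists>w\<in>X. h w \<le> (1 - t) * h u + t * h v \<and> (\<forall>m. g m w \<le> (1 - t) * g m u + t * g m v)"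
    and slater: "\<exists>x\<in>X. \<forall>m. g m x < 0"
    and lower: "\<And>x. x \<in> X \<Longrightarrow> \<forall>m. g m x \<le> 0 \<Longrightarrow> p \<le> h x"
  shows "\<exists>c::real^'m. (\<forall>m. 0 \<le> c $ m) \<and> (\<forall>x\<in>X. p \<le> h x + (\<Sum>m\<in>UNIV. c $ m * g m x))"
proof -
  \<comment> \<open>Both inequalities are strict, so the origin in \<open>S\<close> would be a
    feasible point of cost below \<open>p\<close>.\<close>
  define S :: "((real^'m) \<times> real) set" where
    "S = {s. \<exists>x\<in>X. (\<forall>m. g m x < fst s $ m) \<and> h x - p < snd s}"
  have "convex S"
  proof (rule convexI)
    fix s s' and r t :: real
    assume "s \<in> S" "s' \<in> S" and rt: "0 \<le> r" "0 \<le> t" "r + t = 1"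
    then obtain u v where u: "u \<in> X" "\<And>m. g m u < fst s $ m" "h u - p < snd s"
      and v: "v \<in> X" "\<And>m. g m v < fst s' $ m" "h v - p < snd s'"
      unfolding S_def by blast
    have r: "r = 1 - t" and "t \<in> {0..1}" using rt by auto
    obtain w where w: "w \<in> X" "h w \<le> r * h u + t * h v" "\<And>m. g m w \<le> r * g m u + t * g m v"
      using convex_like[OF u(1) v(1) \<open>t \<in> {0..1}\<close>] r by blast
    \<comment> \<open>One of the weights may be zero; strictness survives because they sum to
      one.\<close>
    have strict: "r * \<alpha> + t * \<beta> < r * \<alpha>' + t * \<beta>'" if "\<alpha> < \<alpha>'" "\<beta> < \<beta>'" for \<alpha> \<beta> \<alpha>' \<beta>' :: real
      using convex_bound_lt[of "\<alpha> - \<alpha>'" 0 "\<beta> - \<beta>'" r t] that rt by (simp add: algebra_simps)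
    have "g m w < fst (r *\<^sub>R s + t *\<^sub>R s') $ m" for m
      using w(3)[of m] strict[OF u(2)[of m] v(2)[of m]] by simp
    moreover have "h w - p < snd (r *\<^sub>R s + t *\<^sub>R s')"
    proof -
      have "r * p + t * p = p" using rt by (simp flip: distrib_right)
      then show ?thesis using w(2) strict[OF u(3) v(3)] by (simp add: algebra_simps)
    qed
    ultimately show "r *\<^sub>R s + t *\<^sub>R s' \<in> S" unfolding S_def using w(1) by blast
  qed
  moreover have "0 \<notin> S"
    unfolding S_def using lower by (force simp: not_less intro: less_imp_le)
  ultimately have "\<exists>z. z \<noteq> 0 \<and> (\<forall>s\<in>S. 0 \<le> inner z s)"
    by (rule separating_hyperplane_set_0)
  then obtain z where z: "z \<noteq> 0" and "\<forall>s\<in>S. 0 \<le> inner z s" by (elim exE conjE)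
  then have z_nonneg: "0 \<le> inner z s" if "s \<in> S" for s using that by blast
  obtain l \<mu> where lm: "z = (l, \<mu>)" by fastforce
  \<comment> \<open>\<open>A x\<close> pairs the separating normal with the boundary point given by
    \<open>x\<close>; the slacks \<open>w\<close> and \<open>r\<close> below move this point into
    \<open>S\<close>.\<close>
  define A where "A x = (\<Sum>m\<in>UNIV. l $ m * g m x) + \<mu> * (h x - p)" for x
  have sep: "0 \<le> A x + (\<Sum>m\<in>UNIV. l $ m * w m) + \<mu> * r"
    if "x \<in> X" "\<And>m. 0 < w m" "0 < r" for x w r
  proof -
    have "((\<chi> m. g m x + w m), h x - p + r) \<in> S"
      unfolding S_def using that by (auto intro!: bexI[of _ x])
    from z_nonneg[OF this] show ?thesis
      by (simp add: lm A_def inner_vec_def algebra_simps sum.distrib)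
  qed
  \<comment> \<open>A uniform slack \<open>s\<close> shrinking to zero carries the inequality over
    to the boundary point.\<close>
  have A: "0 \<le> A x" if "x \<in> X" for x
  proof (rule intercept_nonneg_of_affine_nonneg)
    fix s :: real assume "0 < s"
    then show "0 \<le> A x + s * ((\<Sum>m\<in>UNIV. l $ m) + \<mu>)"
      using sep[OF that, of "\<lambda>_. s" s] by (simp add: distrib_left sum_distrib_left mult.commute)
  qed
  obtain x0 where x0: "x0 \<in> X" "\<And>m. g m x0 < 0" using slater by blast
  \<comment> \<open>Only the cost slack grows here; for the sign of \<open>l $ k\<close> below, only
    the slack of constraint \<open>k\<close> does.\<close>
  have "0 \<le> \<mu>"
  proof (rule slope_nonneg_of_affine_nonneg)
    fix s :: real assume "0 < s"
    then show "0 \<le> (A x0 + (\<Sum>m\<in>UNIV. l $ m)) + s * \<mu>"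
      using sep[OF x0(1), of "\<lambda>_. 1" s] by (simp add: mult.commute)
  qed
  have l: "0 \<le> l $ k" for k
  proof (rule slope_nonneg_of_affine_nonneg)
    fix s :: real assume "0 < s"
    have "(\<Sum>m\<in>UNIV. l $ m * (1 + (if m = k then s else 0))) = (\<Sum>m\<in>UNIV. l $ m) + s * l $ k"
    proof -
      have "l $ m * (1 + (if m = k then s else 0)) = l $ m + (if m = k then s * l $ m else 0)" for m
        by (simp add: distrib_left)
      then show ?thesis by (simp add: sum.distrib)
    qed
    then show "0 \<le> (A x0 + (\<Sum>m\<in>UNIV. l $ m) + \<mu>) + s * l $ k"
      using sep[OF x0(1), of "\<lambda>m. 1 + (if m = k then s else 0)" 1] \<open>0 < s\<close>
      by (simp add: add_pos_nonneg)
  qed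
  \<comment> \<open>The hyperplane is not vertical: if \<open>\<mu>\<close> were zero,
    \<open>A x0\<close> would be a nonnegative sum of nonpositive terms, so every term vanishes. As
    \<open>g m x0\<close> is strictly negative, \<open>l\<close> is zero too, against
    \<open>z \<noteq> 0\<close>.\<close>
  have "\<mu> \<noteq> 0"
  proof
    assume "\<mu> = 0"
    then have "0 \<le> (\<Sum>m\<in>UNIV. l $ m * g m x0)" using A[OF x0(1)] by (simp add: A_def)
    moreover have nonpos: "l $ m * g m x0 \<le> 0" for m
      using l[of m] x0(2)[of m] by (simp add: mult_nonneg_nonpos)
    moreover have "(\<Sum>m\<in>UNIV. l $ m * g m x0) \<le> 0"
      using nonpos by (intro sum_nonpos)
    ultimately have "(\<Sum>m\<in>UNIV. l $ m * g m x0) = 0" by linarith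
    then have "l $ m * g m x0 = 0" for m
      using nonpos sum_nonneg_eq_0_iff[of UNIV "\<lambda>m. - (l $ m * g m x0)"] by (simp add: sum_negf)
    then have "l $ m = 0" for m using x0(2)[of m] by (metis mult_eq_0_iff less_irrefl)
    then have "l = 0" by (simp add: Finite_Cartesian_Product.vec_eq_iff)
    with \<open>\<mu> = 0\<close> z lm show False by (simp add: zero_prod_def)
  qed
  with \<open>0 \<le> \<mu>\<close> have "0 < \<mu>" by simp
  have "p \<le> h x + (\<Sum>m\<in>UNIV. ((1 / \<mu>) *\<^sub>R l) $ m * g m x)" if "x \<in> X" for x
  proof -
    have "(\<Sum>m\<in>UNIV. ((1 / \<mu>) *\<^sub>R l) $ m * g m x) = (1 / \<mu>) * (\<Sum>m\<in>UNIV. l $ m * g m x)"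
      by (simp add: sum_distrib_left)
    moreover have "p \<le> h x + (1 / \<mu>) * (\<Sum>m\<in>UNIV. l $ m * g m x)"
      using A[OF that] \<open>0 < \<mu>\<close> by (simp add: A_def field_simps)
    ultimately show ?thesis by (simp only:)
  qed
  moreover have "0 \<le> ((1 / \<mu>) *\<^sub>R l) $ m" for m using l \<open>0 < \<mu>\<close> by simp
  ultimately show ?thesis by blast
qed

section \<open>The graph Laplacian\<close>

lemma sum_neighbours_swap:
  fixes F :: "'n::finite \<Rightarrow> 'n \<Rightarrow> 'a::comm_monoid_add"
  assumes "sym E"
  shows "(\<Sum>i\<in>UNIV. \<Sum>j\<in>E `` {i}. F i j) = (\<Sum>i\<in>UNIV. \<Sum>j\<in>E `` {i}. F j i)"
proof -
  \<comment> \<open>Indicators of edges make the inner range independent of \<open>i\<close>, so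
    that the two sums can be interchanged.\<close>
  have 1: "(\<Sum>j\<in>E `` {i}. G j) = (\<Sum>j\<in>UNIV. if (i, j) \<in> E then G j else 0)" for i and G :: "'n \<Rightarrow> 'a"
    by (simp add: sum.If_cases Image_singleton)
  have "(i, j) \<in> E \<longleftrightarrow> (j, i) \<in> E" for i j using assms by (auto dest: symD)
  then show ?thesis unfolding 1 by (subst sum.swap) simp
qed

text \<open>The degree terms \<open>u i * w i\<close> agree on both sides, and the cross terms agree
  by exchanging the ends of each edge.\<close>

lemma graph_laplacian_self_adjoint:
  fixes u w :: "'n::finite \<Rightarrow> real"
  assumes "sym E"
  shows "(\<Sum>i\<in>UNIV. u i * (\<Sum>j\<in>E `` {i}. w i - w j)) = (\<Sum>i\<in>UNIV. w i * (\<Sum>j\<in>E `` {i}. u i - u j))"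
  using sum_neighbours_swap[OF assms, of "\<lambda>i j. u i * w j"]
  by (simp add: sum_distrib_left right_diff_distrib sum_subtractf mult.commute mult.left_commute)

lemma sum_graph_laplacian:
  fixes w :: "'n::finite \<Rightarrow> real"
  assumes "sym E"
  shows "(\<Sum>i\<in>UNIV. \<Sum>j\<in>E `` {i}. w i - w j) = 0"
  using graph_laplacian_self_adjoint[OF assms, of "\<lambda>_. 1" w] by simp

lemma local_constraint_shift:
  "local_constraint E a b i y' m x =
    local_constraint E a b i y m x + (\<Sum>j\<in>E `` {i}. (y' - y) $ m $ i - (y' - y) $ m $ j)"
  by (simp add: local_constraint_def sum_subtractf right_diff_distrib)

text \<open>For each constraint, \<open>zeta\<close> is the Laplacian of the multipliers over the
  agents. Self-adjointness moves the Laplacian onto \<open>w\<close>, leaving a sum of one term per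
  agent that matches the local lower bounds.\<close>

lemma inner_zeta:
  assumes "sym E"
  shows "inner (zeta E c) w =
    (\<Sum>i\<in>UNIV. \<Sum>m\<in>UNIV. c i $ m * (\<Sum>j\<in>E `` {i}. w $ m $ i - w $ m $ j))"
proof -
  have "inner (zeta E c) w =
      (\<Sum>m\<in>UNIV. \<Sum>i\<in>UNIV. w $ m $ i * (\<Sum>j\<in>E `` {i}. c i $ m - c j $ m))"
    by (simp add: zeta_def inner_vec_def mult.commute)
  also have "\<dots> = (\<Sum>m\<in>UNIV. \<Sum>i\<in>UNIV. c i $ m * (\<Sum>j\<in>E `` {i}. w $ m $ i - w $ m $ j))"
    by (intro sum.cong refl graph_laplacian_self_adjoint[OF assms, of "\<lambda>i. w $ _ $ i" "\<lambda>i. c i $ _"])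
  also have "\<dots> = (\<Sum>i\<in>UNIV. \<Sum>m\<in>UNIV. c i $ m * (\<Sum>j\<in>E `` {i}. w $ m $ i - w $ m $ j))"
    by (rule sum.swap)
  finally show ?thesis .
qed

section \<open>Criteria for convexity and against strong convexity\<close>

lemma convex_on_of_subgradients:
  fixes g :: "'v::real_inner \<Rightarrow> real"
  assumes "\<And>y. \<exists>s. \<forall>y'. g y + inner s (y' - y) \<le> g y'"
  shows "convex_on UNIV g"
proof (rule convex_onI)
  fix t :: real and u v :: 'v assume t: "0 < t" "t < 1"
  define z where "z = (1 - t) *\<^sub>R u + t *\<^sub>R v"
  obtain s where s: "\<And>y'. g z + inner s (y' - z) \<le> g y'" using assms by blast
  have "(1 - t) * (g z + inner s (u - z)) + t * (g z + inner s (v - z)) \<le> (1 - t) * g u + t * g v"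
    using s t by (intro add_mono mult_left_mono) auto
  \<comment> \<open>The linear terms cancel because \<open>z\<close> is the weighted mean of
    \<open>u\<close> and \<open>v\<close>.\<close>
  moreover have "(1 - t) * inner s (u - z) + t * inner s (v - z) = 0"
    by (simp add: z_def inner_diff_right inner_add_right algebra_simps)
  ultimately have "g z \<le> (1 - t) * g u + t * g v" by (simp add: algebra_simps)
  then show "g ((1 - t) *\<^sub>R u + t *\<^sub>R v) \<le> (1 - t) * g u + t * g v" unfolding z_def .
qed simp

lemma not_strongly_convex_of_invariant:
  assumes "w \<noteq> 0" and "\<And>y. g (y + w) = g y"
    and "\<And>y. g (y + (1 / 2) *\<^sub>R w) = g y"
  shows "\<not> strongly_convex g"
proof
  assume "strongly_convex g"
  then obtain \<mu> where "0 < \<mu>" and \<mu>: "\<And>u v t. t \<in> {0..1} \<Longrightarrow>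
      g ((1 - t) *\<^sub>R u + t *\<^sub>R v) \<le> (1 - t) * g u + t * g v - \<mu> / 2 * t * (1 - t) * (norm (u - v))\<^sup>2"
    unfolding strongly_convex_def by blast
  \<comment> \<open>This is the gap \<open>\<mu> / 2 * t * (1 - t)\<close> times the squared
    distance at the midpoint of \<open>0\<close> and \<open>w\<close>, where \<open>g\<close> takes
    the same value as at both ends.\<close>
  have "0 < \<mu> / 8 * (norm w)\<^sup>2" using \<open>0 < \<mu>\<close> assms(1) by simp
  then show False
    using \<mu>[of "1 / 2" 0 w] assms(2)[of 0] assms(3)[of 0] by simp
qed

section \<open>Finiteness, multipliers and subgradients for the coupled problem\<close>

context coupled_problem
begin

text \<open>Summed over all agents, the neighbour differences of \<open>y\<close> cancel, so the
  local constraints add up to the coupled ones.\<close>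

lemma coupled_feasible_of_local:
  assumes "\<And>i. x i \<in> local_feasible E d a b i y"
  shows "x \<in> coupled_feasible d a b"
proof -
  have "(\<Sum>i\<in>UNIV. scalar_prod (a i m) (x i) + b i m) \<le> 0" for m
  proof -
    have "(\<Sum>i\<in>UNIV. scalar_prod (a i m) (x i) + b i m) =
        (\<Sum>i\<in>UNIV. local_constraint E a b i y m (x i))"
      using sum_graph_laplacian[OF graph_sym, of "\<lambda>i. y $ m $ i"]
      by (simp add: local_constraint_def sum.distrib)
    also have "\<dots> \<le> 0" using assms by (intro sum_nonpos) (simp add: local_feasible_def)
    finally show ?thesis .
  qed
  then show ?thesis using assms by (simp add: coupled_feasible_def local_feasible_def)
qed

lemma local_feasible_nonempty: "\<exists>x. x \<in> local_feasible E d a b i y"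
  using strictly_feasible[of i y] unfolding local_feasible_def by (auto intro: less_imp_le)

text \<open>With feasible decisions of the other agents held fixed, each feasible decision of agent
  \<open>i\<close> completes to a coupled feasible point. The coupled optimum minus the fixed cost
  \<open>R\<close> then bounds the local value from below; any feasible point bounds it from
  above.\<close>

lemma local_value_finite: "\<bar>local_value E d f a b i y\<bar> \<noteq> \<infinity>"
proof -
  obtain p where p: "coupled_value d f a b = ereal p" using finite_value by auto
  have "\<forall>j. \<exists>x. x \<in> local_feasible E d a b j y" using local_feasible_nonempty by blast
  from choice[OF this] obtain xs where xs: "\<And>j. xs j \<in> local_feasible E d a b j y" by blast
  define R where "R = (\<Sum>j\<in>UNIV - {i}. f j (xs j))"
  have "ereal (p - R) \<le> local_value E d f a b i y"
    unfolding local_value_def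
  proof (rule INF_greatest)
    fix x assume x: "x \<in> local_feasible E d a b i y"
    then have "xs(i := x) \<in> coupled_feasible d a b"
      using xs by (intro coupled_feasible_of_local[where y = y]) simp
    then have "ereal p \<le> ereal (\<Sum>j\<in>UNIV. f j ((xs(i := x)) j))"
      unfolding p[symmetric] coupled_value_def by (rule INF_lower)
    also have "(\<Sum>j\<in>UNIV. f j ((xs(i := x)) j)) = f i x + R"
      unfolding R_def by (subst sum.remove[of _ i]) auto
    finally show "ereal (p - R) \<le> ereal (f i x)" by simp
  qed
  moreover have "local_value E d f a b i y \<le> ereal (f i (xs i))"
    unfolding local_value_def using xs by (rule INF_lower)
  ultimately show ?thesis by (cases "local_value E d f a b i y") auto
qed

lemma total_value_finite: "\<bar>total_value E d f a b y\<bar> \<noteq> \<infinity>"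
  unfolding total_value_def using local_value_finite by (simp add: sum_Inf)

text \<open>\<open>slater_multiplier\<close> with \<open>p\<close> the local value gives one
  inequality of strong duality. The other is weak duality: on feasible points the penalty is
  nonpositive.\<close>

lemma lagrange_multiplier_exists: "\<exists>c. lagrange_multiplier E d f a b i y c"
proof -
  obtain p where p: "local_value E d f a b i y = ereal p"
    using local_value_finite[of i y] by auto
  have "\<exists>w\<in>carrier_vec (d i). f i w \<le> (1 - t) * f i u + t * f i v \<and>
      (\<forall>m. local_constraint E a b i y m w
        \<le> (1 - t) * local_constraint E a b i y m u + t * local_constraint E a b i y m v)"
    if u: "u \<in> carrier_vec (d i)" and v: "v \<in> carrier_vec (d i)" and t: "t \<in> {0..1}" for u v t
  proof (intro bexI conjI allI)
    let ?w = "(1 - t) \<cdot>\<^sub>v u + t \<cdot>\<^sub>v v"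
    show "?w \<in> carrier_vec (d i)" using u v by simp
    show "f i ?w \<le> (1 - t) * f i u + t * f i v"
      using convex_cost[of i] u v t by (simp add: convex_carrier_def)
    fix m
    have "scalar_prod (a i m) ?w = (1 - t) * scalar_prod (a i m) u + t * scalar_prod (a i m) v"
      using dim_coeff[of i m] u v by (simp add: scalar_prod_add_distrib[where n = "d i"])
    then show "local_constraint E a b i y m ?w
        \<le> (1 - t) * local_constraint E a b i y m u + t * local_constraint E a b i y m v"
      by (simp add: local_constraint_def algebra_simps)
  qed
  moreover have "p \<le> f i x" if "x \<in> carrier_vec (d i)" "\<forall>m. local_constraint E a b i y m x \<le> 0" for x
  proof -
    have "ereal p \<le> ereal (f i x)"
      unfolding p[symmetric] local_value_def using that
      by (intro INF_lower) (simp add: local_feasible_def)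
    then show ?thesis by simp
  qed
  ultimately obtain c :: "real^'m" where c: "\<And>m. 0 \<le> c $ m"
    and lower: "\<And>x. x \<in> carrier_vec (d i) \<Longrightarrow>
      p \<le> f i x + (\<Sum>m\<in>UNIV. c $ m * local_constraint E a b i y m x)"
    using slater_multiplier[of "carrier_vec (d i)" "f i" "local_constraint E a b i y" p]
      strictly_feasible[of i y] by blast
  let ?L = "\<lambda>x. f i x + (\<Sum>m\<in>UNIV. c $ m * local_constraint E a b i y m x)"
  have "local_value E d f a b i y = (INF x\<in>carrier_vec (d i). ereal (?L x))"
  proof (rule antisym)
    show "local_value E d f a b i y \<le> (INF x\<in>carrier_vec (d i). ereal (?L x))"
      unfolding p using lower by (intro INF_greatest) simp
    show "(INF x\<in>carrier_vec (d i). ereal (?L x)) \<le> local_value E d f a b i y"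
      unfolding local_value_def
    proof (rule INF_mono)
      fix x assume x: "x \<in> local_feasible E d a b i y"
      then have "(\<Sum>m\<in>UNIV. c $ m * local_constraint E a b i y m x) \<le> 0"
        using c by (intro sum_nonpos mult_nonneg_nonpos) (auto simp: local_feasible_def)
      with x show "\<exists>x'\<in>carrier_vec (d i). ereal (?L x') \<le> ereal (f i x)"
        by (intro bexI[of _ x]) (auto simp: local_feasible_def)
    qed
  qed
  with c show ?thesis unfolding lagrange_multiplier_def by blast
qed

text \<open>The multiplier for \<open>y\<close> is tested on points feasible for \<open>y'\<close>.
  Passing from \<open>y\<close> to \<open>y'\<close> shifts each constraint by a term independent of
  \<open>x\<close>, and the penalty at \<open>y'\<close> is nonpositive.\<close>

lemma local_value_lower_bound:
  assumes c: "lagrange_multiplier E d f a b i y c"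
  shows "local_value E d f a b i y +
      ereal (\<Sum>m\<in>UNIV. c $ m * (\<Sum>j\<in>E `` {i}. (y' - y) $ m $ i - (y' - y) $ m $ j))
    \<le> local_value E d f a b i y'" (is "_ + ereal ?\<delta> \<le> _")
proof -
  obtain p where p: "local_value E d f a b i y = ereal p"
    using local_value_finite[of i y] by auto
  have "ereal (p + ?\<delta>) \<le> ereal (f i x)" if x: "x \<in> local_feasible E d a b i y'" for x
  proof -
    have "ereal p \<le> ereal (f i x + (\<Sum>m\<in>UNIV. c $ m * local_constraint E a b i y m x))"
      using c x unfolding p[symmetric] lagrange_multiplier_def
      by (auto simp: local_feasible_def intro!: INF_lower)
    moreover have "(\<Sum>m\<in>UNIV. c $ m * local_constraint E a b i y m x) + ?\<delta> =
        (\<Sum>m\<in>UNIV. c $ m * local_constraint E a b i y' m x)"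
      unfolding local_constraint_shift[of E a b i y' _ x y]
      by (simp add: distrib_left sum.distrib)
    moreover have "\<dots> \<le> 0"
      using c x by (intro sum_nonpos mult_nonneg_nonpos)
        (auto simp: local_feasible_def lagrange_multiplier_def)
    ultimately show ?thesis by simp
  qed
  then have "ereal (p + ?\<delta>) \<le> local_value E d f a b i y'"
    unfolding local_value_def[of _ _ _ _ _ _ y'] by (rule INF_greatest)
  then show ?thesis by (simp add: p)
qed

lemma zeta_subgradient:
  assumes "\<And>i. lagrange_multiplier E d f a b i y (c i)"
  shows "zeta E c \<in> subdifferential (total_value E d f a b) y"
  unfolding subdifferential_def
proof (intro CollectI allI)
  fix y'
  have "total_value E d f a b y + ereal (inner (zeta E c) (y' - y)) =
      (\<Sum>i\<in>UNIV. local_value E d f a b i y +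
        ereal (\<Sum>m\<in>UNIV. c i $ m * (\<Sum>j\<in>E `` {i}. (y' - y) $ m $ i - (y' - y) $ m $ j)))"
    unfolding total_value_def inner_zeta[OF graph_sym] sum.distrib by simp
  also have "\<dots> \<le> total_value E d f a b y'"
    unfolding total_value_def using assms by (intro sum_mono local_value_lower_bound)
  finally show "total_value E d f a b y' \<ge> total_value E d f a b y + ereal (inner (zeta E c) (y' - y))" .
qed

lemma total_value_convex: "convex_on UNIV (\<lambda>y. real_of_ereal (total_value E d f a b y))"
proof (rule convex_on_of_subgradients)
  fix y
  have "\<forall>i. \<exists>c. lagrange_multiplier E d f a b i y c" using lagrange_multiplier_exists by blast
  from choice[OF this] obtain c where c: "\<And>i. lagrange_multiplier E d f a b i y (c i)" by blast
  have "real_of_ereal (total_value E d f a b y) + inner (zeta E c) (y' - y)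
      \<le> real_of_ereal (total_value E d f a b y')" for y'
  proof -
    have "total_value E d f a b y + ereal (inner (zeta E c) (y' - y)) \<le> total_value E d f a b y'"
      using zeta_subgradient[OF c] by (simp add: subdifferential_def)
    \<comment> \<open>Both total values are finite, so the extended real inequality transfers to the
      reals.\<close>
    then show ?thesis
      using total_value_finite[of y] total_value_finite[of y']
      by (cases "total_value E d f a b y"; cases "total_value E d f a b y'") auto
  qed
  then show "\<exists>s. \<forall>y'. real_of_ereal (total_value E d f a b y) + inner s (y' - y)
      \<le> real_of_ereal (total_value E d f a b y')" by blast
qed

text \<open>The local constraints see \<open>y\<close> only through differences between
  agents.\<close>

lemma total_value_shift: "total_value E d f a b (y + (\<chi> m i. r)) = total_value E d f a b y"
proof -
  have "local_constraint E a b i (y + (\<chi> m i. r)) = local_constraint E a b i y" for i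
    by (simp add: local_constraint_def fun_eq_iff)
  then show ?thesis by (simp add: total_value_def local_value_def local_feasible_def)
qed

lemma total_value_not_strongly_convex:
  "\<not> strongly_convex (\<lambda>y. real_of_ereal (total_value E d f a b y))"
proof (rule not_strongly_convex_of_invariant[where w = "\<chi> m i. 1"])
  show "((\<chi> m i. 1) :: real^'n^'m) \<noteq> 0" by (simp add: Finite_Cartesian_Product.vec_eq_iff)
  have "(1 / 2) *\<^sub>R (\<chi> m i. 1) = ((\<chi> m i. 1 / 2) :: real^'n^'m)"
    by (simp add: Finite_Cartesian_Product.vec_eq_iff)
  then show "real_of_ereal (total_value E d f a b (y + (1 / 2) *\<^sub>R (\<chi> m i. 1)))
      = real_of_ereal (total_value E d f a b y)" for y
    by (simp only: total_value_shift)
qed (simp add: total_value_shift)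

end

section \<open>An instance with several multipliers\<close>

text \<open>
  Minimising \<open>\<bar>x\<bar>\<close> subject to \<open>x \<le> 0\<close> admits every multiplier in \<open>[0, 1]\<close>.
\<close>

lemma lagrange_multiplier_not_unique:
  "\<exists>(E::('n::finite \<times> 'n) set) d f (a::'n \<Rightarrow> 'm::finite \<Rightarrow> real Matrix.vec) b.
     coupled_problem E d f a b \<and>
     (\<exists>y i c c'. lagrange_multiplier E d f a b i y c \<and>
                  lagrange_multiplier E d f a b i y c' \<and> c \<noteq> c')"
proof -
  \<comment> \<open>The complete graph is connected on every finite index type.\<close>
  define E :: "('n \<times> 'n) set" where "E = UNIV - Id"
  define d :: "'n \<Rightarrow> nat" where "d = (\<lambda>_. 1)"
  define f :: "'n \<Rightarrow> real Matrix.vec \<Rightarrow> real" where "f = (\<lambda>_ x. \<bar>vec_index x 0\<bar>)"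
  define a :: "'n \<Rightarrow> 'm \<Rightarrow> real Matrix.vec" where "a = (\<lambda>_ _. Matrix.vec 1 (\<lambda>_. 1))"
  define b :: "'n \<Rightarrow> 'm \<Rightarrow> real" where "b = (\<lambda>_ _. 0)"
  have a_prod: "scalar_prod (a i m) x = vec_index x 0" if "x \<in> carrier_vec 1" for i m x
    using that by (simp add: a_def scalar_prod_def)
  have "coupled_problem E d f a b"
  proof
    show "sym E" "irrefl E" by (auto simp: E_def sym_def irrefl_def)
    show "(i, j) \<in> E\<^sup>*" for i j by (cases "i = j") (auto simp: E_def)
    show "a i m \<in> carrier_vec (d i)" for i m by (simp add: a_def d_def)
    show "convex_carrier (d i) (f i)" for i
      unfolding convex_carrier_def
    proof (intro ballI)
      fix u v :: "real Matrix.vec" and t :: real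
      assume uv: "u \<in> carrier_vec (d i)" "v \<in> carrier_vec (d i)" and t: "t \<in> {0..1}"
      have "\<bar>(1 - t) * vec_index u 0 + t * vec_index v 0\<bar>
          \<le> \<bar>(1 - t) * vec_index u 0\<bar> + \<bar>t * vec_index v 0\<bar>" by (rule abs_triangle_ineq)
      then show "f i ((1 - t) \<cdot>\<^sub>v u + t \<cdot>\<^sub>v v) \<le> (1 - t) * f i u + t * f i v"
        using uv t by (simp add: f_def d_def abs_mult)
    qed
    have "0 \<le> coupled_value d f a b"
      unfolding coupled_value_def by (intro INF_greatest) (simp add: f_def sum_nonneg)
    moreover have "coupled_value d f a b \<le> ereal (\<Sum>i\<in>(UNIV::'n set). f i (0\<^sub>v 1))"
      unfolding coupled_value_def
      by (rule INF_lower) (simp add: coupled_feasible_def d_def b_def a_prod)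
    ultimately show "\<bar>coupled_value d f a b\<bar> \<noteq> \<infinity>" by (cases "coupled_value d f a b") auto
    show "\<exists>x\<in>carrier_vec (d i). \<forall>m. local_constraint E a b i y m x < 0" for i and y :: "real^'n^'m"
    proof -
      define r where "r m = (\<Sum>j\<in>E `` {i}. y $ m $ i - y $ m $ j)" for m
      \<comment> \<open>The single entry is so negative that every constraint is at most -1 at
        once.\<close>
      define x where "x = Matrix.vec 1 (\<lambda>_. - (\<Sum>m\<in>UNIV. \<bar>r m\<bar>) - 1)"
      have x: "x \<in> carrier_vec 1" by (simp add: x_def)
      have "r m \<le> (\<Sum>m\<in>UNIV. \<bar>r m\<bar>)" for m
        using member_le_sum[of m UNIV "\<lambda>m. \<bar>r m\<bar>"] by simp
      then have "local_constraint E a b i y m x < 0" for m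
        using a_prod[OF x] by (simp add: local_constraint_def b_def x_def flip: r_def)
          (smt (verit))
      then show ?thesis using x by (auto simp: d_def)
    qed
  qed
  \<comment> \<open>All weight \<open>t\<close> sits on one constraint \<open>k\<close>. The
    Lagrangian is then |x| + t x, which is nonnegative for \<open>t\<close> in [0, 1] and vanishes
    at 0, as does the local value.\<close>
  moreover have "lagrange_multiplier E d f a b i 0 (t *\<^sub>R axis k 1)"
    if t: "t \<in> {0..1}" for t :: real and i k
  proof -
    have constraint: "local_constraint E a b i 0 m x = vec_index x 0" if "x \<in> carrier_vec 1" for m x
      using a_prod[OF that] by (simp add: local_constraint_def b_def)
    have zero: "(INF x\<in>A. ereal (h x)) = 0" if "0\<^sub>v 1 \<in> A" "h (0\<^sub>v 1) = 0" "\<And>x. x \<in> A \<Longrightarrow> 0 \<le> h x"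
      for A and h :: "real Matrix.vec \<Rightarrow> real"
      using that by (intro antisym INF_greatest INF_lower2[of "0\<^sub>v 1"]) auto
    have "local_value E d f a b i 0 = 0"
      unfolding local_value_def
      by (rule zero) (auto simp: local_feasible_def d_def constraint f_def)
    moreover have "(INF x\<in>carrier_vec (d i). ereal (f i x +
        (\<Sum>m\<in>UNIV. (t *\<^sub>R axis k 1) $ m * local_constraint E a b i 0 m x))) = 0"
    proof (rule zero)
      have sum: "(\<Sum>m\<in>UNIV. (t *\<^sub>R axis k 1) $ m * local_constraint E a b i 0 m x) = t * vec_index x 0"
        if "x \<in> carrier_vec 1" for x
        using constraint[OF that] by (simp add: axis_def if_distrib[of "\<lambda>s. t * s"]
            if_distrib[of "\<lambda>s. s * _"] cong: if_cong)
      show "0\<^sub>v 1 \<in> carrier_vec (d i)" by (simp add: d_def)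
      show "f i (0\<^sub>v 1) +
          (\<Sum>m\<in>UNIV. (t *\<^sub>R axis k 1) $ m * local_constraint E a b i 0 m (0\<^sub>v 1)) = 0"
        by (subst sum) (simp_all add: f_def)
      fix x :: "real Matrix.vec" assume "x \<in> carrier_vec (d i)"
      moreover have "\<bar>t * vec_index x 0\<bar> \<le> \<bar>vec_index x 0\<bar>"
        using t by (simp add: abs_mult mult_left_le_one_le)
      ultimately show "0 \<le> f i x +
          (\<Sum>m\<in>UNIV. (t *\<^sub>R axis k 1) $ m * local_constraint E a b i 0 m x)"
        by (subst sum) (auto simp: d_def f_def)
    qed
    ultimately show ?thesis using t by (simp add: lagrange_multiplier_def axis_def)
  qed
  from this[of 0] this[of 1] have "lagrange_multiplier E d f a b i 0 0"
    "lagrange_multiplier E d f a b i 0 (axis k 1)" for i k by auto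
  moreover have "(0::real^'m) \<noteq> axis k 1" for k by (simp add: axis_def Finite_Cartesian_Product.vec_eq_iff)
  ultimately show ?thesis by blast
qed

text \<open>Non-uniqueness is rendered as the existence, over the same index types, of an instance
  with two distinct multipliers. Finiteness of the total value is part of the conclusion, so that
  \<open>real_of_ereal\<close> loses nothing in the convexity claims.\<close>

theorem proposition3:
  fixes E :: "('n::finite \<times> 'n) set"
    and d :: "'n \<Rightarrow> nat"
    and f :: "'n \<Rightarrow> real Matrix.vec \<Rightarrow> real"
    and a :: "'n \<Rightarrow> 'm::finite \<Rightarrow> real Matrix.vec"
    and b :: "'n \<Rightarrow> 'm \<Rightarrow> real"
  assumes "coupled_problem E d f a b"
  shows "(\<forall>(y::real^'n^'m) i. \<exists>c. lagrange_multiplier E d f a b i y c) \<and>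
    (\<exists>(E'::('n \<times> 'n) set) d' f' (a'::'n \<Rightarrow> 'm \<Rightarrow> real Matrix.vec) b'.
       coupled_problem E' d' f' a' b' \<and>
       (\<exists>y i c c'. lagrange_multiplier E' d' f' a' b' i y c \<and>
                    lagrange_multiplier E' d' f' a' b' i y c' \<and> c \<noteq> c')) \<and>
    (\<forall>y. \<bar>total_value E d f a b y\<bar> \<noteq> \<infinity>) \<and>
    convex_on UNIV (\<lambda>y. real_of_ereal (total_value E d f a b y)) \<and>
    \<not> strongly_convex (\<lambda>y. real_of_ereal (total_value E d f a b y)) \<and>
    (\<forall>(y::real^'n^'m) c. (\<forall>i. lagrange_multiplier E d f a b i y (c i)) \<longrightarrow>
       zeta E c \<in> subdifferential (total_value E d f a b) y)"
proof -
  interpret coupled_problem E d f a b by fact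
  show ?thesis
    using lagrange_multiplier_exists lagrange_multiplier_not_unique total_value_finite
      total_value_convex total_value_not_strongly_convex zeta_subgradient
    by (intro conjI) blast+
qed

end
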